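(* Let $G$ be a group, $U$ a set, and $f_G$ a normal soft int-group in $G$ over $U$. Define a soft set $f_G^{(\ast)}:G/f_G\to P(U)$ by $f_G^{(\ast)}(xf_G)=f_G(x)$ for all $x\in G$. Then $f_G^{(\ast)}$ is a (well-defined) normal soft int-group in the group $G/f_G$ over $U$.
   Context: Let $P(U)$ be the power set of $U$. For a group $K$, a soft int-group in $K$ over $U$ is a function $f_K:K\to P(U)$ such that $f_K(xy)\supseteq f_K(x)\cap f_K(y)$ and $f_K(x^{-1})=f_K(x)$ for all $x,y\in K$; it is a normal soft int-group in $K$ if moreover $f_K(xy)=f_K(yx)$ for all $x,y\in K$. For $a\in G$, the soft coset $af_G:G\to P(U)$ is defined by $(af_G)(x)=f_G(a^{-1}x)$. The soft product of functions $f,g:G\to P(U)$ is $(f\ast g)(x)=\bigcup\{f(u)\cap g(v): u,v\in G,\ uv=x\}$. For $f_G$ a normal soft int-group in $G$, the quotient group $G/f_G$ is the set $\{xf_G:x\in G\}$ with operation $\ast$, which is a group satisfying $(xf_G)\ast(yf_G)=(xy)f_G$. *)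

theory Defs
  imports "HOL-Algebra.Group"
begin

text \<open>
  Only the values of a soft set on the carrier matter. Soft cosets, soft products and the
  induced soft set on the quotient are taken to be extensional (undefined off the carrier),
  so that equality of soft cosets in HOL is equality as functions on the group.
\<close>

locale soft_int_group = group K for K (structure) +
  fixes U :: "'u set" and f :: "'a \<Rightarrow> 'u set"
  assumes soft_set: "f \<in> carrier K \<rightarrow> Pow U"
    and inter_subset_mult: "\<lbrakk>x \<in> carrier K; y \<in> carrier K\<rbrakk> \<Longrightarrow> f x \<inter> f y \<subseteq> f (x \<otimes> y)"
    and inv_eq: "x \<in> carrier K \<Longrightarrow> f (inv x) = f x"

locale normal_soft_int_group = soft_int_group +
  assumes commute: "\<lbrakk>x \<in> carrier K; y \<in> carrier K\<rbrakk> \<Longrightarrow> f (x \<otimes> y) = f (y \<otimes> x)"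

definition soft_coset :: "('a, 'm) monoid_scheme \<Rightarrow> ('a \<Rightarrow> 'u set) \<Rightarrow> 'a \<Rightarrow> 'a \<Rightarrow> 'u set"
  where "soft_coset G f a = (\<lambda>x\<in>carrier G. f (inv\<^bsub>G\<^esub> a \<otimes>\<^bsub>G\<^esub> x))"

definition soft_product ::
    "('a, 'm) monoid_scheme \<Rightarrow> ('a \<Rightarrow> 'u set) \<Rightarrow> ('a \<Rightarrow> 'u set) \<Rightarrow> 'a \<Rightarrow> 'u set"
  where "soft_product G f g =
    (\<lambda>x\<in>carrier G. \<Union>{f u \<inter> g v | u v. u \<in> carrier G \<and> v \<in> carrier G \<and> u \<otimes>\<^bsub>G\<^esub> v = x})"

text \<open>The record format requires a unit; it is the soft coset of the unit of \<open>G\<close>.\<close>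

definition soft_quotient :: "('a, 'm) monoid_scheme \<Rightarrow> ('a \<Rightarrow> 'u set) \<Rightarrow> ('a \<Rightarrow> 'u set) monoid"
  where "soft_quotient G f =
    \<lparr>carrier = soft_coset G f ` carrier G,
     mult = soft_product G,
     one = soft_coset G f \<one>\<^bsub>G\<^esub>\<rparr>"

text \<open>
  The assignment sending the soft coset of \<open>x\<close> to \<open>f x\<close>. The description operator is
  meaningful only if \<open>f x\<close> does not depend on the representative \<open>x\<close>; this
  well-definedness is not built in and has to be proved.
\<close>

definition soft_quotient_map ::
    "('a, 'm) monoid_scheme \<Rightarrow> ('a \<Rightarrow> 'u set) \<Rightarrow> ('a \<Rightarrow> 'u set) \<Rightarrow> 'u set"
  where "soft_quotient_map G f =
    (\<lambda>C\<in>carrier (soft_quotient G f). THE A. \<exists>x\<in>carrier G. C = soft_coset G f x \<and> A = f x)"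

end

theory Submission
  imports Defs
begin

text \<open>The value of the soft coset of \<open>x\<close> at \<open>\<one>\<close> is
  \<open>f (inv x)\<close>, that is \<open>f x\<close>, so equal cosets force equal values of
  \<open>f\<close> (\<open>soft_coset_eqD\<close>) and the induced map is well defined. By
  \<open>soft_product_soft_coset\<close>, sending \<open>x\<close> to its soft coset is
  multiplicative. The quotient is therefore the homomorphic image of a group, and each condition on
  the induced map reduces to the same condition on \<open>f\<close> at representatives.\<close>

context soft_int_group
begin

text \<open>The unit is \<open>x \<otimes> inv x\<close>, and \<open>f\<close> agrees on the two
  factors. Consequently intersecting a value of \<open>f\<close> with \<open>f \<one>\<close> does
  not shrink it.\<close>

lemma subset_one: "x \<in> carrier K \<Longrightarrow> f x \<subseteq> f \<one>"
  using inter_subset_mult[of x "inv x"] inv_eq[of x] by simp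

lemma soft_coset_eqD:
  assumes "x \<in> carrier K" "y \<in> carrier K" "soft_coset K f x = soft_coset K f y"
  shows "f x = f y"
  using fun_cong[OF assms(3), of \<one>] assms(1,2) by (simp add: soft_coset_def inv_eq)

text \<open>Uniqueness for the description operator is exactly \<open>soft_coset_eqD\<close>. All
  later reasoning about the induced map goes through this equation.\<close>

lemma soft_quotient_map_soft_coset:
  assumes "x \<in> carrier K"
  shows "soft_quotient_map K f (soft_coset K f x) = f x"
proof -
  have "(THE A. \<exists>y\<in>carrier K. soft_coset K f x = soft_coset K f y \<and> A = f y) = f x"
    using assms by (intro the_equality) (auto dest: soft_coset_eqD)
  then show ?thesis
    using assms by (simp add: soft_quotient_map_def soft_quotient_def)
qed

end

context normal_soft_int_group
begin

text \<open>At a point \<open>z\<close>, every factorisation \<open>u \<otimes> v = z\<close>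
  contributes a set below \<open>f (inv (x \<otimes> y) \<otimes> z)\<close>, and one factorisation
  attains this bound.\<close>

lemma soft_product_soft_coset:
  assumes [simp]: "x \<in> carrier K" "y \<in> carrier K"
  shows "soft_product K (soft_coset K f x) (soft_coset K f y) = soft_coset K f (x \<otimes> y)"
proof
  fix z
  show "soft_product K (soft_coset K f x) (soft_coset K f y) z = soft_coset K f (x \<otimes> y) z"
  proof (cases "z \<in> carrier K")
    case [simp]: True
    have "f (inv x \<otimes> u) \<inter> f (inv y \<otimes> v) \<subseteq> f (inv (x \<otimes> y) \<otimes> z)"
      if [simp]: "u \<in> carrier K" "v \<in> carrier K" and z: "u \<otimes> v = z" for u v
    proof -
      \<comment> \<open>Normality moves \<open>inv y\<close> to the right of \<open>v\<close>, so
        that \<open>u\<close> and \<open>v\<close> become adjacent and merge into \<open>z\<close>;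
        a second use below brings \<open>inv y\<close> back to the front.\<close>
      have "f (inv x \<otimes> u) \<inter> f (inv y \<otimes> v) = f (inv x \<otimes> u) \<inter> f (v \<otimes> inv y)"
        by (simp add: commute[of "inv y"])
      also have "\<dots> \<subseteq> f ((inv x \<otimes> u) \<otimes> (v \<otimes> inv y))"
        by (intro inter_subset_mult) simp_all
      also have "\<dots> = f ((inv x \<otimes> z) \<otimes> inv y)"
        by (simp add: m_assoc flip: z)
      also have "\<dots> = f (inv y \<otimes> (inv x \<otimes> z))"
        by (intro commute) simp_all
      also have "\<dots> = f (inv (x \<otimes> y) \<otimes> z)"
        by (simp add: inv_mult_group m_assoc)
      finally show ?thesis .
    qed
    \<comment> \<open>The bound is attained at \<open>u = x\<close>,
      \<open>v = inv x \<otimes> z\<close>: the first factor is then \<open>f \<one>\<close>, which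
      contains every value of \<open>f\<close>.\<close>
    moreover have "f (inv (x \<otimes> y) \<otimes> z) \<subseteq> f (inv x \<otimes> x) \<inter> f (inv y \<otimes> (inv x \<otimes> z))"
      using subset_one[of "inv (x \<otimes> y) \<otimes> z"] by (simp add: inv_mult_group m_assoc)
    moreover have "x \<otimes> (inv x \<otimes> z) = z"
      by (simp flip: m_assoc)
    ultimately have "\<Union>{f (inv x \<otimes> u) \<inter> f (inv y \<otimes> v) | u v.
        u \<in> carrier K \<and> v \<in> carrier K \<and> u \<otimes> v = z} = f (inv (x \<otimes> y) \<otimes> z)"
      by (intro equalityI Sup_least CollectI
          Sup_upper2[of "f (inv x \<otimes> x) \<inter> f (inv y \<otimes> (inv x \<otimes> z))"]
          exI[of _ x] exI[of _ "inv x \<otimes> z"] conjI refl) auto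
    moreover have "soft_product K (soft_coset K f x) (soft_coset K f y) z =
        \<Union>{f (inv x \<otimes> u) \<inter> f (inv y \<otimes> v) | u v.
          u \<in> carrier K \<and> v \<in> carrier K \<and> u \<otimes> v = z}"
      by (auto simp: soft_product_def soft_coset_def)
    ultimately show ?thesis
      by (simp add: soft_coset_def)
  qed (simp add: soft_product_def soft_coset_def)
qed

lemma soft_coset_hom: "soft_coset K f \<in> hom K (soft_quotient K f)"
  by (auto simp: hom_def soft_quotient_def soft_product_soft_coset)

text \<open>The image of a group under a homomorphism is a group, so the group laws for
  \<open>soft_product\<close> on cosets are inherited from \<open>K\<close>.\<close>

lemma group_soft_quotient: "group (soft_quotient K f)"
  using hom_imp_img_group[OF soft_coset_hom] by (simp add: soft_quotient_def)

lemma normal_soft_int_group_soft_quotient: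
  "normal_soft_int_group (soft_quotient K f) U (soft_quotient_map K f)"
proof -
  have hom: "group_hom K (soft_quotient K f) (soft_coset K f)"
    by (intro group_hom.intro group_hom_axioms.intro is_group group_soft_quotient soft_coset_hom)
  \<comment> \<open>Oriented to rewrite products and inverses of cosets as single cosets, where
    \<open>soft_quotient_map_soft_coset\<close> applies.\<close>
  note map_mult = hom_mult[OF soft_coset_hom, symmetric]
    and map_inv = group_hom.hom_inv[OF hom, symmetric]
  have carrier: "carrier (soft_quotient K f) = soft_coset K f ` carrier K"
    by (simp add: soft_quotient_def)
  show ?thesis
  proof (intro normal_soft_int_group.intro soft_int_group.intro soft_int_group_axioms.intro
      normal_soft_int_group_axioms.intro group_soft_quotient)
    show "soft_quotient_map K f \<in> carrier (soft_quotient K f) \<rightarrow> Pow U"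
      using soft_set by (auto simp: carrier soft_quotient_map_soft_coset Pi_iff)
  next
    fix C D
    assume "C \<in> carrier (soft_quotient K f)" "D \<in> carrier (soft_quotient K f)"
    then obtain x y where [simp]: "x \<in> carrier K" "y \<in> carrier K"
      and CD: "C = soft_coset K f x" "D = soft_coset K f y"
      by (auto simp: carrier)
    show "soft_quotient_map K f C \<inter> soft_quotient_map K f D
        \<subseteq> soft_quotient_map K f (C \<otimes>\<^bsub>soft_quotient K f\<^esub> D)"
      by (simp add: CD soft_quotient_map_soft_coset inter_subset_mult map_mult)
  next
    fix C
    assume "C \<in> carrier (soft_quotient K f)"
    then show "soft_quotient_map K f (inv\<^bsub>soft_quotient K f\<^esub> C) = soft_quotient_map K f C"
      by (auto simp: carrier soft_quotient_map_soft_coset inv_eq map_inv)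
  next
    fix C D
    assume "C \<in> carrier (soft_quotient K f)" "D \<in> carrier (soft_quotient K f)"
    then obtain x y where [simp]: "x \<in> carrier K" "y \<in> carrier K"
      and CD: "C = soft_coset K f x" "D = soft_coset K f y"
      by (auto simp: carrier)
    show "soft_quotient_map K f (C \<otimes>\<^bsub>soft_quotient K f\<^esub> D) =
        soft_quotient_map K f (D \<otimes>\<^bsub>soft_quotient K f\<^esub> C)"
      by (simp add: CD soft_quotient_map_soft_coset commute[of x y] map_mult)
  qed
qed

end

theorem theorem3p39:
  fixes G :: "('a, 'm) monoid_scheme" and U :: "'u set" and f :: "'a \<Rightarrow> 'u set"
  assumes "normal_soft_int_group G U f"
  shows "(\<forall>x\<in>carrier G. \<forall>y\<in>carrier G. soft_coset G f x = soft_coset G f y \<longrightarrow> f x = f y)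
    \<and> (\<forall>x\<in>carrier G. soft_quotient_map G f (soft_coset G f x) = f x)
    \<and> normal_soft_int_group (soft_quotient G f) U (soft_quotient_map G f)"
proof -
  interpret normal_soft_int_group G U f
    by (rule assms)
  show ?thesis
    using soft_coset_eqD soft_quotient_map_soft_coset normal_soft_int_group_soft_quotient by blast
qed

end
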